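(* (d'Ocagne's identity) Let $n,r$ be any nonnegative integers. Then $$m\mathbb{O}_{k,r}m\mathbb{O}_{k,n+1}-m\mathbb{O}_{k,r+1}m\mathbb{O}_{k,n}=\sqrt{9k^2-8}\,\left(\beta\alpha\lambda_1^{n}\lambda_2^{r}-\alpha\beta\lambda_1^{r}\lambda_2^{n}\right),$$ where $\alpha=\sum_{s=0}^{7}\lambda_1^{s}e_s$ and $\beta=\sum_{s=0}^{7}\lambda_2^{s}e_s$.
   Context: $\mathbb{O}$ denotes the octonions, the $8$-dimensional real (non-commutative, non-associative) algebra with basis $e_0=1,e_1,\dots,e_7$ and bilinear multiplication determined by: $e_0$ is the identity, $e_a^2=-1$ for $a\ge1$, $e_ae_b=-e_be_a$ for distinct $a,b\ge1$, and $e_ae_b=e_c$, $e_be_c=e_a$, $e_ce_a=e_b$ for $(a,b,c)\in\{(1,2,3),(1,4,5),(1,7,6),(2,4,6),(2,5,7),(3,4,7),(3,6,5)\}$. For a parameter $k$, the $k$-Mersenne-Lucas numbers are defined by $m_{k,0}=2$, $m_{k,1}=3k$, $m_{k,n+1}=3km_{k,n}-2m_{k,n-1}$ for $n\ge1$. The $n$-th $k$-Mersenne-Lucas octonion is $m\mathbb{O}_{k,n}=\sum_{s=0}^{7}m_{k,n+s}e_s$ for $n\ge 0$. The numbers $\lambda_1=\frac{3k+\sqrt{9k^2-8}}{2}$ and $\lambda_2=\frac{3k-\sqrt{9k^2-8}}{2}$ are the roots of $\lambda^2-3k\lambda+2=0$, and $\lambda_1-\lambda_2=\sqrt{9k^2-8}$.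 *)

theory Defs
  imports Complex_Main
begin

section \<open>Octonions\<close>

text \<open>
  An octonion with coefficients in \<^typ>\<open>'a\<close> is its coordinate sequence with respect to
  $e_0,\dots,e_7$.  The octonions proper have real coefficients; complex coefficients give
  their complexification.
\<close>

typedef (overloaded) 'a octonion = "{f :: nat \<Rightarrow> 'a::zero. \<forall>i\<ge>8. f i = 0}"
  morphisms oct_coeff Abs_octonion
  by (rule exI[of _ "\<lambda>_. 0"]) simp

setup_lifting type_definition_octonion

lemma octonion_eqI: "(\<And>i. i < 8 \<Longrightarrow> oct_coeff x i = oct_coeff y i) \<Longrightarrow> x = y"
  by transfer (auto simp: fun_eq_iff not_less, metis not_less)

lemma oct_coeff_ge8: "i \<ge> 8 \<Longrightarrow> oct_coeff x i = 0"
  by transfer simp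

instantiation octonion :: (ab_group_add) ab_group_add
begin

lift_definition zero_octonion :: "'a octonion" is "\<lambda>_. 0" by simp

lift_definition plus_octonion :: "'a octonion \<Rightarrow> 'a octonion \<Rightarrow> 'a octonion"
  is "\<lambda>x y i. x i + y i" by simp

lift_definition uminus_octonion :: "'a octonion \<Rightarrow> 'a octonion"
  is "\<lambda>x i. - x i" by simp

lift_definition minus_octonion :: "'a octonion \<Rightarrow> 'a octonion \<Rightarrow> 'a octonion"
  is "\<lambda>x y i. x i - y i" by simp

instance by standard (transfer; simp add: fun_eq_iff algebra_simps)+

end

lift_definition oct_e :: "nat \<Rightarrow> 'a::zero_neq_one octonion"
  is "\<lambda>s i. if i = s \<and> s < 8 then 1 else 0" by simp

lift_definition oct_scale :: "'a::comm_ring_1 \<Rightarrow> 'a octonion \<Rightarrow> 'a octonion"  (infixr "*\<^sub>O" 75)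
  is "\<lambda>c x i. c * x i" by simp

definition oct_triples :: "(nat \<times> nat \<times> nat) set" where
  "oct_triples = {(1,2,3), (1,4,5), (1,7,6), (2,4,6), (2,5,7), (3,4,7), (3,6,5)}"

definition oct_cyclic :: "nat \<Rightarrow> nat \<Rightarrow> nat \<Rightarrow> bool" where
  "oct_cyclic a b c \<longleftrightarrow>
     (a, b, c) \<in> oct_triples \<or> (b, c, a) \<in> oct_triples \<or> (c, a, b) \<in> oct_triples"

text \<open>Structure constants: \<open>oct_struct i j l\<close> is the coefficient of $e_l$ in $e_i e_j$.\<close>

definition oct_struct :: "nat \<Rightarrow> nat \<Rightarrow> nat \<Rightarrow> int" where
  "oct_struct i j l =
     (if i = 0 then (if l = j then 1 else 0)
      else if j = 0 then (if l = i then 1 else 0)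
      else if i = j then (if l = 0 then - 1 else 0)
      else if oct_cyclic i j l then 1
      else if oct_cyclic j i l then - 1
      else 0)"

instantiation octonion :: (comm_ring_1) times
begin

lift_definition times_octonion :: "'a octonion \<Rightarrow> 'a octonion \<Rightarrow> 'a octonion"
  is "\<lambda>x y l. if l < 8 then \<Sum>i<8. \<Sum>j<8. of_int (oct_struct i j l) * x i * y j else 0"
  by simp

instance ..

end

lift_definition oct_complexify :: "real octonion \<Rightarrow> complex octonion"
  is "\<lambda>x i. complex_of_real (x i)" by simp

lemma oct_coeff_zero [simp]: "oct_coeff 0 i = 0"
  by transfer simp

lemma oct_coeff_add [simp]: "oct_coeff (x + y) i = oct_coeff x i + oct_coeff y i"
  by transfer simp

lemma oct_coeff_minus [simp]: "oct_coeff (- x) i = - oct_coeff x i"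
  by transfer simp

lemma oct_coeff_diff [simp]: "oct_coeff (x - y) i = oct_coeff x i - oct_coeff y i"
  by transfer simp

lemma oct_coeff_scale [simp]: "oct_coeff (c *\<^sub>O x) i = c * oct_coeff x i"
  by transfer simp

lemma oct_coeff_e: "oct_coeff (oct_e s) i = (if i = s \<and> s < 8 then 1 else 0)"
  by transfer simp

lemma oct_coeff_times:
  "oct_coeff (x * y) l =
     (if l < 8 then \<Sum>i<8. \<Sum>j<8. of_int (oct_struct i j l) * oct_coeff x i * oct_coeff y j else 0)"
  by transfer simp

lemma oct_coeff_complexify [simp]:
  "oct_coeff (oct_complexify x) i = complex_of_real (oct_coeff x i)"
  by transfer simp

lemma oct_coeff_sum [simp]: "oct_coeff (sum f A) i = (\<Sum>s\<in>A. oct_coeff (f s) i)"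
  by (induction A rule: infinite_finite_induct) auto

lemma oct_expansion: "x = (\<Sum>s=0..7. oct_coeff x s *\<^sub>O oct_e s)"
  by (rule octonion_eqI) (simp add: oct_coeff_e if_distrib[of "\<lambda>u. _ * u"] cong: if_cong)

lemma oct_times_bilinear:
  fixes x y z :: "'a::comm_ring_1 octonion"
  shows "(x + y) * z = x * z + y * z"
    and "x * (y + z) = x * y + x * z"
    and "(c *\<^sub>O x) * y = c *\<^sub>O (x * y)"
    and "x * (c *\<^sub>O y) = c *\<^sub>O (x * y)"
proof -
  show "(x + y) * z = x * z + y * z"
    by (rule octonion_eqI) (simp add: oct_coeff_times distrib_left distrib_right sum.distrib)
  show "x * (y + z) = x * y + x * z"
    by (rule octonion_eqI) (simp add: oct_coeff_times distrib_left distrib_right sum.distrib)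
  show "(c *\<^sub>O x) * y = c *\<^sub>O (x * y)"
    by (rule octonion_eqI) (simp add: oct_coeff_times sum_distrib_left mult_ac)
  show "x * (c *\<^sub>O y) = c *\<^sub>O (x * y)"
    by (rule octonion_eqI) (simp add: oct_coeff_times sum_distrib_left mult_ac)
qed

lemma oct_coeff_e_times_e:
  assumes "a < 8" "b < 8" "l < 8"
  shows "oct_coeff (oct_e a * oct_e b :: 'a::comm_ring_1 octonion) l = of_int (oct_struct a b l)"
proof -
  have "oct_coeff (oct_e a * oct_e b :: 'a octonion) l =
      (\<Sum>i<8::nat. \<Sum>j<8::nat. if j = b then (if i = a then of_int (oct_struct a b l) else 0) else 0)"
    unfolding oct_coeff_times using assms
    by (simp only: if_True, intro sum.cong refl) (auto simp: oct_coeff_e)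
  also have "\<dots> = of_int (oct_struct a b l)"
    using assms by (simp add: sum.delta)
  finally show ?thesis .
qed

lemma oct_one_times: "oct_e 0 * x = x"
proof (rule octonion_eqI)
  fix l :: nat assume l: "l < 8"
  have "oct_coeff (oct_e 0 * x) l =
      (\<Sum>i<8::nat. \<Sum>j<8::nat. if j = l then (if i = 0 then oct_coeff x l else 0) else 0)"
    unfolding oct_coeff_times using l
    by (auto simp only: oct_coeff_e oct_struct_def if_True intro!: sum.cong) auto
  then show "oct_coeff (oct_e 0 * x) l = oct_coeff x l"
    using l by (simp add: sum.delta)
qed

lemma oct_times_one: "x * oct_e 0 = x"
proof (rule octonion_eqI)
  fix l :: nat assume l: "l < 8"
  have "oct_coeff (x * oct_e 0) l =
      (\<Sum>i<8::nat. \<Sum>j<8::nat. if j = 0 then (if i = l then oct_coeff x l else 0) else 0)"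
    unfolding oct_coeff_times using l
    by (auto simp only: oct_coeff_e oct_struct_def if_True intro!: sum.cong) auto
  then show "oct_coeff (x * oct_e 0) l = oct_coeff x l"
    using l by (simp add: sum.delta)
qed

lemma oct_e_square: "1 \<le> a \<Longrightarrow> a < 8 \<Longrightarrow> oct_e a * oct_e a = - oct_e 0"
  by (rule octonion_eqI) (simp add: oct_coeff_e_times_e oct_coeff_e oct_struct_def)

lemma oct_cyclicD:
  assumes "oct_cyclic a b c"
  shows "0 < a" "0 < b" "0 < c" "a < 8" "b < 8" "c < 8" "a \<noteq> b"
    and "oct_cyclic a b d \<longleftrightarrow> d = c" and "\<not> oct_cyclic b a d"
proof -
  have "(a, b, c) \<in> {(1,2,3), (1,4,5), (1,7,6), (2,4,6), (2,5,7), (3,4,7), (3,6,5),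
                      (2,3,1), (4,5,1), (7,6,1), (4,6,2), (5,7,2), (4,7,3), (6,5,3),
                      (3,1,2), (5,1,4), (6,1,7), (6,2,4), (7,2,5), (7,3,4), (5,3,6)}"
    using assms unfolding oct_cyclic_def oct_triples_def
    by (elim disjE; simp; elim disjE; simp)
  then show "0 < a" "0 < b" "0 < c" "a < 8" "b < 8" "c < 8" "a \<noteq> b"
    and "oct_cyclic a b d \<longleftrightarrow> d = c" and "\<not> oct_cyclic b a d"
    unfolding insert_iff empty_iff prod.inject
    by (elim disjE conjE FalseE; simp add: oct_cyclic_def oct_triples_def)+
qed

lemma oct_e_anticommute:
  assumes "1 \<le> a" "a < 8" "1 \<le> b" "b < 8" "a \<noteq> b"
  shows "oct_e a * oct_e b = - (oct_e b * oct_e a)"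
  using assms oct_cyclicD(9)[of a b]
  by (intro octonion_eqI) (auto simp: oct_coeff_e_times_e oct_struct_def)

lemma oct_e_times_cyclic:
  assumes "oct_cyclic a b c"
  shows "oct_e a * oct_e b = oct_e c"
  by (rule octonion_eqI)
     (use oct_cyclicD[OF assms] in \<open>auto simp: oct_coeff_e_times_e oct_coeff_e oct_struct_def\<close>)

lemma oct_e_times_triple:
  assumes "(a, b, c) \<in> oct_triples"
  shows "oct_e a * oct_e b = oct_e c" "oct_e b * oct_e c = oct_e a" "oct_e c * oct_e a = oct_e b"
  using assms by (auto intro!: oct_e_times_cyclic simp: oct_cyclic_def)

section \<open>\<open>k\<close>-Mersenne-Lucas numbers and octonions\<close>

fun mersenne_lucas :: "'a::comm_ring_1 \<Rightarrow> nat \<Rightarrow> 'a" where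
  "mersenne_lucas k 0 = 2"
| "mersenne_lucas k (Suc 0) = 3 * k"
| "mersenne_lucas k (Suc (Suc n)) = 3 * k * mersenne_lucas k (Suc n) - 2 * mersenne_lucas k n"

definition mersenne_lucas_oct :: "'a::comm_ring_1 \<Rightarrow> nat \<Rightarrow> 'a octonion" where
  "mersenne_lucas_oct k n = (\<Sum>s=0..7. mersenne_lucas k (n + s) *\<^sub>O oct_e s)"

text \<open>The octonions $\alpha$ and $\beta$ are \<open>power_oct\<close> of $\lambda_1$ and $\lambda_2$.
  If $9k^2 < 8$, these roots are not real, so that $\alpha$ and $\beta$ lie in the complexified
  octonions only; \<open>oct_complexify\<close> embeds the real octonions there.\<close>

definition power_oct :: "'a::comm_ring_1 \<Rightarrow> 'a octonion" where
  "power_oct l = (\<Sum>s=0..7. l ^ s *\<^sub>O oct_e s)"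

end

theory Submission
  imports Defs
begin

text \<open>
  Over any commutative ring, if $\lambda_1 + \lambda_2 = 3k$ and $\lambda_1\lambda_2 = 2$, then
  both power sequences satisfy the Mersenne-Lucas recurrence, which gives the Binet formula
  $m_{k,n} = \lambda_1^n + \lambda_2^n$ and, coordinatewise, the octonion
  $\lambda_1^n\alpha + \lambda_2^n\beta$ (\<open>mersenne_lucas_oct_binet\<close>).  Multiplication of
  octonions is bilinear, so the left-hand side of d'Ocagne's identity expands into multiples of
  $\alpha\alpha$, $\alpha\beta$, $\beta\alpha$ and $\beta\beta$.  The squares carry the same
  power in both products and cancel.  In the mixed terms the two products differ by one shifted
  exponent, which leaves the factor $\lambda_1 - \lambda_2$, with opposite signs for
  $\beta\alpha$ and $\alpha\beta$; these must be kept apart, as octonions do not commute.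

  The real and the complex case are two instances of this computation.  Mersenne-Lucas
  octonions are real for every real $k$; when the roots are complex, the identity is read in the
  complexification, whose embedding respects differences and products and sends
  Mersenne-Lucas octonions to Mersenne-Lucas octonions.
\<close>

lemma mersenne_lucas_binet:
  fixes k a b :: "'a::comm_ring_1"
  assumes "a + b = 3 * k" and "a * b = 2"
  shows "mersenne_lucas k n = a ^ n + b ^ n"
proof (induction n rule: induct_nat_012)
  case (ge2 n)
  then have "mersenne_lucas k (Suc (Suc n)) =
      (a + b) * (a ^ Suc n + b ^ Suc n) - a * b * (a ^ n + b ^ n)"
    by (simp add: assms)
  then show ?case
    by (simp add: algebra_simps)
qed (simp_all add: assms)

lemma oct_coeff_power_oct: "i < 8 \<Longrightarrow> oct_coeff (power_oct a) i = a ^ i"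
  unfolding power_oct_def
  by (simp add: oct_coeff_e if_distrib[of "\<lambda>u. _ * u"] cong: if_cong)

lemma oct_coeff_mersenne_lucas_oct:
  "i < 8 \<Longrightarrow> oct_coeff (mersenne_lucas_oct k n) i = mersenne_lucas k (n + i)"
  unfolding mersenne_lucas_oct_def
  by (simp add: oct_coeff_e if_distrib[of "\<lambda>u. _ * u"] cong: if_cong)

lemma mersenne_lucas_oct_binet:
  fixes k a b :: "'a::comm_ring_1"
  assumes "a + b = 3 * k" and "a * b = 2"
  shows "mersenne_lucas_oct k n = a ^ n *\<^sub>O power_oct a + b ^ n *\<^sub>O power_oct b"
  by (rule octonion_eqI)
     (simp add: oct_coeff_mersenne_lucas_oct oct_coeff_power_oct
        mersenne_lucas_binet[OF assms] power_add)

lemma mersenne_lucas_oct_dOcagne: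
  fixes k a b :: "'a::comm_ring_1"
  assumes "a + b = 3 * k" and "a * b = 2"
  shows "mersenne_lucas_oct k r * mersenne_lucas_oct k (n + 1)
      - mersenne_lucas_oct k (r + 1) * mersenne_lucas_oct k n
    = (a - b) *\<^sub>O ((a ^ n * b ^ r) *\<^sub>O (power_oct b * power_oct a)
        - (a ^ r * b ^ n) *\<^sub>O (power_oct a * power_oct b))"
  unfolding mersenne_lucas_oct_binet[OF assms] oct_times_bilinear
  by (rule octonion_eqI) (simp add: algebra_simps)

lemma oct_complexify_diff: "oct_complexify (x - y) = oct_complexify x - oct_complexify y"
  by (rule octonion_eqI) simp

lemma oct_complexify_times: "oct_complexify (x * y) = oct_complexify x * oct_complexify y"
  by (rule octonion_eqI) (simp add: oct_coeff_times)

lemma of_real_mersenne_lucas: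
  "complex_of_real (mersenne_lucas k n) = mersenne_lucas (complex_of_real k) n"
  by (induction k n rule: mersenne_lucas.induct) simp_all

lemma oct_complexify_mersenne_lucas_oct:
  "oct_complexify (mersenne_lucas_oct k n) = mersenne_lucas_oct (complex_of_real k) n"
  by (rule octonion_eqI) (simp add: oct_coeff_mersenne_lucas_oct of_real_mersenne_lucas)

text \<open>Vieta's relations depend on the square root of the discriminant only through its square.
  Stating them for an arbitrary such \<open>d\<close> covers the real and the complex square root together.\<close>

lemma mersenne_lucas_roots:
  fixes k d :: "'a::field_char_0"
  assumes "d\<^sup>2 = 9 * k\<^sup>2 - 8"
  shows "(3 * k + d) / 2 + (3 * k - d) / 2 = 3 * k"
    and "(3 * k + d) / 2 * ((3 * k - d) / 2) = 2"
    and "(3 * k + d) / 2 - (3 * k - d) / 2 = d"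
proof -
  have "(3 * k + d) * (3 * k - d) = 9 * k\<^sup>2 - d\<^sup>2"
    by (simp add: algebra_simps power2_eq_square)
  then have "(3 * k + d) * (3 * k - d) = 8"
    by (simp add: assms)
  then show "(3 * k + d) / 2 * ((3 * k - d) / 2) = 2"
    by simp
qed (simp_all add: field_simps)

theorem theorem3p5:
  fixes k :: real and n r :: nat
  shows
    "(8 \<le> 9 * k\<^sup>2 \<longrightarrow>
      (let lam1 = (3 * k + sqrt (9 * k\<^sup>2 - 8)) / 2;
           lam2 = (3 * k - sqrt (9 * k\<^sup>2 - 8)) / 2;
           \<alpha> = power_oct lam1;
           \<beta> = power_oct lam2
       in mersenne_lucas_oct k r * mersenne_lucas_oct k (n + 1)
            - mersenne_lucas_oct k (r + 1) * mersenne_lucas_oct k n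
          = sqrt (9 * k\<^sup>2 - 8) *\<^sub>O
              ((lam1 ^ n * lam2 ^ r) *\<^sub>O (\<beta> * \<alpha>) - (lam1 ^ r * lam2 ^ n) *\<^sub>O (\<alpha> * \<beta>))))
     \<and>
     (let d = csqrt (complex_of_real (9 * k\<^sup>2 - 8));
          lam1 = (3 * complex_of_real k + d) / 2;
          lam2 = (3 * complex_of_real k - d) / 2;
          \<alpha> = power_oct lam1;
          \<beta> = power_oct lam2
      in oct_complexify
           (mersenne_lucas_oct k r * mersenne_lucas_oct k (n + 1)
              - mersenne_lucas_oct k (r + 1) * mersenne_lucas_oct k n)
         = d *\<^sub>O
             ((lam1 ^ n * lam2 ^ r) *\<^sub>O (\<beta> * \<alpha>) - (lam1 ^ r * lam2 ^ n) *\<^sub>O (\<alpha> * \<beta>)))"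
proof (intro conjI impI)
  assume "8 \<le> 9 * k\<^sup>2"
  then have d: "(sqrt (9 * k\<^sup>2 - 8))\<^sup>2 = 9 * k\<^sup>2 - 8"
    by simp
  show "let lam1 = (3 * k + sqrt (9 * k\<^sup>2 - 8)) / 2;
           lam2 = (3 * k - sqrt (9 * k\<^sup>2 - 8)) / 2;
           \<alpha> = power_oct lam1;
           \<beta> = power_oct lam2
       in mersenne_lucas_oct k r * mersenne_lucas_oct k (n + 1)
            - mersenne_lucas_oct k (r + 1) * mersenne_lucas_oct k n
          = sqrt (9 * k\<^sup>2 - 8) *\<^sub>O
              ((lam1 ^ n * lam2 ^ r) *\<^sub>O (\<beta> * \<alpha>) - (lam1 ^ r * lam2 ^ n) *\<^sub>O (\<alpha> * \<beta>))"
    unfolding Let_def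
    using mersenne_lucas_oct_dOcagne[OF mersenne_lucas_roots(1,2)[OF d], of r n]
    unfolding mersenne_lucas_roots(3)[OF d] .
next
  have d: "(csqrt (complex_of_real (9 * k\<^sup>2 - 8)))\<^sup>2 = 9 * (complex_of_real k)\<^sup>2 - 8"
    by simp
  show "let d = csqrt (complex_of_real (9 * k\<^sup>2 - 8));
          lam1 = (3 * complex_of_real k + d) / 2;
          lam2 = (3 * complex_of_real k - d) / 2;
          \<alpha> = power_oct lam1;
          \<beta> = power_oct lam2
      in oct_complexify
           (mersenne_lucas_oct k r * mersenne_lucas_oct k (n + 1)
              - mersenne_lucas_oct k (r + 1) * mersenne_lucas_oct k n)
         = d *\<^sub>O
             ((lam1 ^ n * lam2 ^ r) *\<^sub>O (\<beta> * \<alpha>) - (lam1 ^ r * lam2 ^ n) *\<^sub>O (\<alpha> * \<beta>))"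
    unfolding Let_def oct_complexify_diff oct_complexify_times oct_complexify_mersenne_lucas_oct
    using mersenne_lucas_oct_dOcagne[OF mersenne_lucas_roots(1,2)[OF d], of r n]
    unfolding mersenne_lucas_roots(3)[OF d] .
qed

end
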